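(* Let $\varepsilon>0$ and let $G$ be a finite simple undirected graph with degeneracy $d$. With the priorities $\rho=\langle\rho_{\mathrm{ADG}},\rho_{\mathrm R}\rangle$, JP-ADG colors $G$ with at most $2(1+\varepsilon)d+1$ colors.
   Context: For $U\subseteq V$, $N_U(v)$ denotes the set of neighbors of $v$ lying in $U$. The degeneracy $d$ of $G$ is the smallest $s$ such that every nonempty induced subgraph of $G$ has a vertex of degree at most $s$. Algorithm ADG (parameter $\varepsilon$). Initialize $U=V$, $D[v]=\deg(v)$ for all $v$, $\ell=1$. While $U\neq\emptyset$: compute $\widehat\delta=\frac1{|U|}\sum_{v\in U}D[v]$; set $R=\{u\in U: D[u]\le(1+\varepsilon)\widehat\delta\}$; for all $v\in R$ and all $u\in N_U(v)$, decrement $D[u]$; set $U=U\setminus R$; set $\rho_{\mathrm{ADG}}(v)=\ell$ for all $v\in R$; set $\ell=\ell+1$. (So at the start of each iteration $D[v]$ is the degree of $v$ in $G[U]$ for $v\in U$.) The output is $\rho_{\mathrm{ADG}}$. Algorithm JP (Jones–Plassmann) with a priority function $\rho$ defining a total order on $V$: let $pred[v]=\{u\in N(v):\rho(u)>\rho(v)\}$. Each vertex $v$ is colored once all vertices of $pred[v]$ have been colored; it receives the smallest color in $\{1,\dots,|pred[v]|+1\}$ not used by any vertex of $pred[v]$. JP-ADG: run ADG, then run JP with the lexicographic priority $\rho=\langle\rho_{\mathrm{ADG}},\rho_{\mathrm R}\rangle$, where $\rho_{\mathrm R}$ is a (uniformly random) total order on $V$ used to break ties. *)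

theory Defs
  imports
    Complex_Main
    "HOL-Library.While_Combinator"
    "HOL-Library.Product_Lexorder"
    "Graph_Theory.Graph_Theory"
begin

text \<open>
  Finite simple undirected graphs are the locale \<^locale>\<open>graph\<close>: finite, loop-free, symmetric
  digraphs without parallel arcs. Each undirected edge is a pair of opposite arcs, so
  the degree of a vertex is its \<^const>\<open>out_degree\<close>.
\<close>

definition nbrs :: "('a, 'b) pre_digraph \<Rightarrow> 'a set \<Rightarrow> 'a \<Rightarrow> 'a set" where
  "nbrs G U v = {u \<in> U. v \<rightarrow>\<^bsub>G\<^esub> u}"

definition degeneracy :: "('a, 'b) pre_digraph \<Rightarrow> nat" where
  "degeneracy G = (LEAST s. \<forall>W. W \<subseteq> verts G \<and> W \<noteq> {} \<longrightarrow>
     (\<exists>v \<in> verts (G \<restriction> W). out_degree (G \<restriction> W) v \<le> s))"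


text \<open>
  A state of ADG is \<open>(U, D, l, \<rho>)\<close>. The entries of \<open>D\<close> are integers so that decrementing is not
  truncated at zero. The value of \<open>\<rho>\<close> on vertices without a priority so far is irrelevant; it is
  initialized to \<open>0\<close>. \<open>adg\<close> is \<^const>\<open>None\<close> if the loop does not terminate.
\<close>

type_synonym 'a adg_state = "'a set \<times> ('a \<Rightarrow> int) \<times> nat \<times> ('a \<Rightarrow> nat)"

definition adg_step :: "('a, 'b) pre_digraph \<Rightarrow> real \<Rightarrow> 'a adg_state \<Rightarrow> 'a adg_state" where
  "adg_step G \<epsilon> = (\<lambda>(U, D, l, \<rho>).
     let \<delta> = (\<Sum>v\<in>U. real_of_int (D v)) / real (card U);
         R = {u \<in> U. real_of_int (D u) \<le> (1 + \<epsilon>) * \<delta>}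
     in (U - R,
         \<lambda>u. D u - int (card {v \<in> R. u \<in> nbrs G U v}),
         l + 1,
         \<lambda>v. if v \<in> R then l else \<rho> v))"

definition adg :: "('a, 'b) pre_digraph \<Rightarrow> real \<Rightarrow> ('a \<Rightarrow> nat) option" where
  "adg G \<epsilon> = map_option (\<lambda>(U, D, l, \<rho>). \<rho>)
     (while_option (\<lambda>(U, D, l, \<rho>). U \<noteq> {}) (adg_step G \<epsilon>)
        (verts G, \<lambda>v. int (out_degree G v), 1, \<lambda>_. 0))"


definition jp_pred :: "('a, 'b) pre_digraph \<Rightarrow> ('a \<Rightarrow> 'p::linorder) \<Rightarrow> 'a \<Rightarrow> 'a set" where
  "jp_pred G \<rho> v = {u \<in> nbrs G (verts G) v. \<rho> u > \<rho> v}"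

text \<open>
  JP does not prescribe an order among the vertices that are ready to be colored, so it is a
  nondeterministic transition system on partial colorings. Vertices that are ready
  simultaneously are pairwise non-adjacent, hence coloring them in parallel amounts to coloring
  them one after the other. The argument of \<^const>\<open>Min\<close> is never empty: fewer colors are used
  by the predecessors than are available.
\<close>

inductive jp_step ::
  "('a, 'b) pre_digraph \<Rightarrow> ('a \<Rightarrow> 'p::linorder) \<Rightarrow> ('a \<rightharpoonup> nat) \<Rightarrow> ('a \<rightharpoonup> nat) \<Rightarrow> bool"
  for G \<rho> where
  "\<lbrakk>v \<in> verts G; v \<notin> dom c; jp_pred G \<rho> v \<subseteq> dom c;
    k = Min ({1..card (jp_pred G \<rho> v) + 1} - ran (c |` jp_pred G \<rho> v))\<rbrakk>
   \<Longrightarrow> jp_step G \<rho> c (c(v \<mapsto> k))"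

text \<open>
  The outputs are the results of maximal runs. A run on a finite graph is always finite, since
  every step colors a new vertex; that a maximal run colors every vertex is not built in.
\<close>

definition jp_output ::
  "('a, 'b) pre_digraph \<Rightarrow> ('a \<Rightarrow> 'p::linorder) \<Rightarrow> ('a \<rightharpoonup> nat) \<Rightarrow> bool" where
  "jp_output G \<rho> c \<longleftrightarrow> (jp_step G \<rho>)\<^sup>*\<^sup>* Map.empty c \<and> (\<nexists>c'. jp_step G \<rho> c c')"

text \<open>The order on pairs is the lexicographic one.\<close>

definition jp_adg_output ::
  "('a, 'b) pre_digraph \<Rightarrow> real \<Rightarrow> ('a \<Rightarrow> 'r::linorder) \<Rightarrow> ('a \<rightharpoonup> nat) \<Rightarrow> bool" where
  "jp_adg_output G \<epsilon> \<rho>R c \<longleftrightarrow>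
     (\<exists>\<rho>A. adg G \<epsilon> = Some \<rho>A \<and> jp_output G (\<lambda>v. (\<rho>A v, \<rho>R v)) c)"

definition proper_coloring :: "('a, 'b) pre_digraph \<Rightarrow> ('a \<rightharpoonup> nat) \<Rightarrow> bool" where
  "proper_coloring G c \<longleftrightarrow> dom c = verts G \<and> (\<forall>u v. u \<rightarrow>\<^bsub>G\<^esub> v \<longrightarrow> c u \<noteq> c v)"

end

theory Submission
  imports Defs
begin

text \<open>
  Peeling off vertices of minimum degree shows that every induced subgraph on \<open>U\<close> has degree sum
  at most \<open>2 d |U|\<close>, so the average degree computed by ADG never exceeds \<open>2 d\<close>. Hence a vertex
  removed in some round has at most \<open>2 (1 + \<epsilon>) d\<close> neighbors that are removed in the same or in a
  later round, and these include all its JP predecessors. Greedy coloring then gives it a color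
  at most \<open>2 (1 + \<epsilon>) d + 1\<close>.
\<close>

section \<open>Degrees as cardinalities of neighbor sets\<close>

text \<open>Without parallel arcs, \<open>head\<close> is injective on the arcs leaving
  \<open>v\<close>. This links the arc-based \<open>out_degree\<close> to neighbor sets.\<close>

lemma (in nomulti_digraph) card_nbrs:
  "card (nbrs G W v) = card {e \<in> arcs G. tail G e = v \<and> head G e \<in> W}"
proof -
  have "inj_on (head G) {e \<in> arcs G. tail G e = v \<and> head G e \<in> W}"
    by (auto simp: inj_on_def arc_to_ends_def intro: no_multi_arcs)
  moreover have "head G ` {e \<in> arcs G. tail G e = v \<and> head G e \<in> W} = nbrs G W v"
    by (force simp: nbrs_def arcs_ends_conv)
  ultimately show ?thesis
    using card_image by fastforce
qed

lemma (in nomulti_digraph) out_degree_eq_card_nbrs: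
  "out_degree G v = card (nbrs G (verts G) v)"
  unfolding out_degree_def out_arcs_def card_nbrs by (rule arg_cong[where f = card]) auto

lemma (in nomulti_digraph) out_degree_induce_eq_card_nbrs:
  assumes "v \<in> W"
  shows "out_degree (G \<restriction> W) v = card (nbrs G W v)"
  unfolding out_degree_def out_arcs_def card_nbrs using assms
  by (intro arg_cong[where f = card]) auto

lemma finite_nbrs: "finite U \<Longrightarrow> finite (nbrs G U v)"
  by (simp add: nbrs_def)

lemma (in digraph) degeneracy_witness:
  assumes "W \<subseteq> verts G" "W \<noteq> {}"
  shows "\<exists>v\<in>W. card (nbrs G W v) \<le> degeneracy G"
proof -
  let ?P = "\<lambda>s. \<forall>W. W \<subseteq> verts G \<and> W \<noteq> {} \<longrightarrow>
    (\<exists>v \<in> verts (G \<restriction> W). out_degree (G \<restriction> W) v \<le> s)"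
  \<comment> \<open>\<open>LeastI\<close> needs some admissible value before \<open>LEAST\<close>
    says anything; the number of arcs bounds every degree.\<close>
  have "out_degree (G \<restriction> W) v \<le> card (arcs G)" for W v
    unfolding out_degree_def out_arcs_def by (intro card_mono) auto
  then have "?P (card (arcs G))"
    by auto
  then have "?P (degeneracy G)"
    unfolding degeneracy_def by (rule LeastI)
  with assms obtain v where "v \<in> W" "out_degree (G \<restriction> W) v \<le> degeneracy G"
    by auto
  then show ?thesis
    by (metis out_degree_induce_eq_card_nbrs)
qed

section \<open>Degree sums of induced subgraphs\<close>

context graph
begin

lemma dominates_commute: "u \<rightarrow>\<^bsub>G\<^esub> v \<longleftrightarrow> v \<rightarrow>\<^bsub>G\<^esub> u"
  using graph_symmetric by blast

text \<open>Each edge between \<open>v\<close> and \<open>W\<close> is counted twice, once at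
  \<open>v\<close> and once at its other end.\<close>

lemma degree_sum_insert:
  assumes "finite W" "v \<notin> W"
  shows "(\<Sum>u\<in>insert v W. card (nbrs G (insert v W) u)) =
    (\<Sum>u\<in>W. card (nbrs G W u)) + 2 * card (nbrs G W v)"
proof -
  have "\<not> v \<rightarrow>\<^bsub>G\<^esub> v"
    using adj_not_same by blast
  moreover from this have "nbrs G (insert v W) v = nbrs G W v"
    by (auto simp: nbrs_def)
  moreover have "card (nbrs G (insert v W) u) = card (nbrs G W u) + (if v \<rightarrow>\<^bsub>G\<^esub> u then 1 else 0)"
    for u
  proof -
    have "nbrs G (insert v W) u = (if v \<rightarrow>\<^bsub>G\<^esub> u then insert v (nbrs G W u) else nbrs G W u)"
      using dominates_commute by (auto simp: nbrs_def)
    moreover have "v \<notin> nbrs G W u"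
      using assms by (simp add: nbrs_def)
    ultimately show ?thesis
      using assms(1) by (simp add: finite_nbrs)
  qed
  moreover have "(\<Sum>u\<in>W. if v \<rightarrow>\<^bsub>G\<^esub> u then 1 else 0) = card (nbrs G W v)"
    using assms by (simp add: nbrs_def sum.If_cases Int_def)
  ultimately show ?thesis
    using assms by (simp add: sum.distrib)
qed

lemma degree_sum_le:
  assumes "W \<subseteq> verts G"
  shows "(\<Sum>u\<in>W. card (nbrs G W u)) \<le> 2 * degeneracy G * card W"
proof -
  have "finite W"
    using assms by (rule finite_subset) simp
  then show ?thesis
    using assms
  \<comment> \<open>This rule gives the hypothesis for the removal of any element, so the vertex to
    peel off can be chosen depending on \<open>W\<close>.\<close>
  proof (induction W rule: finite_remove_induct)
    case empty
    then show ?case by simp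
  next
    case (remove W)
    obtain v where v: "v \<in> W" "card (nbrs G W v) \<le> degeneracy G"
      using degeneracy_witness remove by blast
    let ?W = "W - {v}"
    have W: "W = insert v ?W" "v \<notin> ?W" "finite ?W"
      using v remove by auto
    have "card (nbrs G ?W v) \<le> card (nbrs G W v)"
      using remove.hyps(1) by (intro card_mono finite_nbrs) (auto simp: nbrs_def)
    then have "card (nbrs G ?W v) \<le> degeneracy G"
      using v by simp
    moreover have "(\<Sum>u\<in>?W. card (nbrs G ?W u)) \<le> 2 * degeneracy G * card ?W"
      using remove v by auto
    moreover have "(\<Sum>u\<in>W. card (nbrs G W u)) =
        (\<Sum>u\<in>?W. card (nbrs G ?W u)) + 2 * card (nbrs G ?W v)"
      using degree_sum_insert[OF W(3,2)] W(1) by simp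
    moreover have "card W = Suc (card ?W)"
      using W by (metis card_insert_disjoint)
    ultimately show ?case
      by (simp add: algebra_simps)
  qed
qed

section \<open>The loop invariant of ADG and termination\<close>

text \<open>
  In the last conjunct, vertices in \<open>U\<close> count as higher in priority because they will receive
  priorities of at least \<open>l\<close>.
\<close>

definition adg_inv :: "real \<Rightarrow> 'a adg_state \<Rightarrow> bool" where
  "adg_inv B = (\<lambda>(U, D, l, \<rho>). U \<subseteq> verts G \<and>
     (\<forall>u\<in>U. D u = int (card (nbrs G U u))) \<and>
     (\<forall>v\<in>verts G - U. \<rho> v < l \<and>
        real (card {u \<in> nbrs G (verts G) v. u \<in> U \<or> \<rho> v \<le> \<rho> u}) \<le> B))"

lemma adg_inv_init: "adg_inv B (verts G, \<lambda>v. int (out_degree G v), 1, \<lambda>_. 0)"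
  by (simp add: adg_inv_def out_degree_eq_card_nbrs)

lemma adg_step_inv:
  assumes inv: "adg_inv (2 * (1 + \<epsilon>) * real (degeneracy G)) (U, D, l, \<rho>)"
    and "U \<noteq> {}" "\<epsilon> \<ge> 0"
    and step: "adg_step G \<epsilon> (U, D, l, \<rho>) = (U', D', l', \<rho>')"
  shows "adg_inv (2 * (1 + \<epsilon>) * real (degeneracy G)) (U', D', l', \<rho>')" and "U' \<subset> U"
proof -
  define \<delta> where "\<delta> = (\<Sum>v\<in>U. real_of_int (D v)) / real (card U)"
  define R where "R = {u \<in> U. real_of_int (D u) \<le> (1 + \<epsilon>) * \<delta>}"
  let ?B = "2 * (1 + \<epsilon>) * real (degeneracy G)"
  have eqs: "U' = U - R" "D' = (\<lambda>u. D u - int (card {v \<in> R. u \<in> nbrs G U v}))" "l' = l + 1"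
    "\<rho>' = (\<lambda>v. if v \<in> R then l else \<rho> v)"
    using step by (simp_all add: adg_step_def Let_def \<delta>_def R_def)
  have UV: "U \<subseteq> verts G" and D: "\<And>u. u \<in> U \<Longrightarrow> D u = int (card (nbrs G U u))"
    and old: "\<And>v. v \<in> verts G - U \<Longrightarrow> \<rho> v < l \<and>
        real (card {u \<in> nbrs G (verts G) v. u \<in> U \<or> \<rho> v \<le> \<rho> u}) \<le> ?B"
    using inv by (auto simp: adg_inv_def)
  have finU: "finite U"
    using UV by (rule finite_subset) simp
  then have cardU: "card U > 0"
    using \<open>U \<noteq> {}\<close> by (simp add: card_gt_0_iff)
  have RU: "R \<subseteq> U"
    by (auto simp: R_def)
  have sumD: "(\<Sum>v\<in>U. real_of_int (D v)) = real (\<Sum>v\<in>U. card (nbrs G U v))"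
    using D by simp
  have "real (\<Sum>v\<in>U. card (nbrs G U v)) \<le> real (2 * degeneracy G * card U)"
    using degree_sum_le[OF UV] by (simp only: of_nat_le_iff)
  then have "\<delta> \<le> 2 * real (degeneracy G)"
    unfolding \<delta>_def sumD using cardU by (simp add: divide_simps)
  then have bound: "(1 + \<epsilon>) * \<delta> \<le> ?B"
    using \<open>\<epsilon> \<ge> 0\<close> mult_left_mono[of \<delta> "2 * real (degeneracy G)" "1 + \<epsilon>"] by (simp add: algebra_simps)
  \<comment> \<open>Nonnegativity makes the threshold \<open>(1 + \<epsilon>) * \<delta>\<close> at
    least the average, so any vertex of at most average degree enters \<open>R\<close>.\<close>
  have "\<delta> \<ge> 0"
    unfolding \<delta>_def sumD by (intro divide_nonneg_nonneg of_nat_0_le_iff)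
  then have le: "\<delta> \<le> (1 + \<epsilon>) * \<delta>"
    using \<open>\<epsilon> \<ge> 0\<close> by (simp add: algebra_simps)
  have "\<exists>u\<in>U. real_of_int (D u) \<le> \<delta>"
  proof (rule ccontr)
    assume "\<not> ?thesis"
    then have "(\<Sum>v\<in>U. \<delta>) < (\<Sum>v\<in>U. real_of_int (D v))"
      using finU \<open>U \<noteq> {}\<close> by (intro sum_strict_mono) auto
    then show False
      using cardU by (simp add: \<delta>_def)
  qed
  then have "R \<noteq> {}"
    using le by (force simp: R_def)
  then show "U' \<subset> U"
    using RU eqs by auto
  have "D' u = int (card (nbrs G U' u))" if "u \<in> U'" for u
  proof -
    \<comment> \<open>The decrement looks from \<open>R\<close> towards \<open>u\<close>; by
      symmetry it counts exactly the neighbors that \<open>u\<close> loses.\<close>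
    have "{v \<in> R. u \<in> nbrs G U v} = nbrs G R u"
      using that RU dominates_commute by (auto simp: nbrs_def eqs)
    moreover have "nbrs G U u = nbrs G U' u \<union> nbrs G R u" "nbrs G U' u \<inter> nbrs G R u = {}"
      using RU by (auto simp: nbrs_def eqs)
    ultimately show ?thesis
      using that D[of u] finU RU card_Un_disjoint[of "nbrs G U' u" "nbrs G R u"]
      by (simp add: eqs finite_nbrs finite_subset)
  qed
  moreover have "\<rho>' v < l' \<and> real (card {u \<in> nbrs G (verts G) v. u \<in> U' \<or> \<rho>' v \<le> \<rho>' u}) \<le> ?B"
    if "v \<in> verts G - U'" for v
  proof (cases "v \<in> R")
    case True
    \<comment> \<open>Neighbors removed in earlier rounds have priority below \<open>l\<close>, the
      new priority of \<open>v\<close>, so only neighbors in \<open>U\<close> remain.\<close>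
    have "{u \<in> nbrs G (verts G) v. u \<in> U' \<or> \<rho>' v \<le> \<rho>' u} \<subseteq> nbrs G U v"
      using True RU old by (fastforce simp: nbrs_def eqs split: if_splits)
    then have "card {u \<in> nbrs G (verts G) v. u \<in> U' \<or> \<rho>' v \<le> \<rho>' u} \<le> card (nbrs G U v)"
      using finU by (intro card_mono finite_nbrs)
    moreover have "real (card (nbrs G U v)) \<le> (1 + \<epsilon>) * \<delta>"
      using True D[of v] by (simp add: R_def)
    ultimately show ?thesis
      using True bound by (simp add: eqs)
  next
    case False
    then have v: "v \<in> verts G - U"
      using that by (auto simp: eqs)
    \<comment> \<open>Neighbors that move into \<open>R\<close> were already counted as members of
      \<open>U\<close>, so the old bound carries over.\<close>
    have "{u \<in> nbrs G (verts G) v. u \<in> U' \<or> \<rho>' v \<le> \<rho>' u}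
        \<subseteq> {u \<in> nbrs G (verts G) v. u \<in> U \<or> \<rho> v \<le> \<rho> u}"
      using False RU by (auto simp: eqs split: if_splits)
    then have "card {u \<in> nbrs G (verts G) v. u \<in> U' \<or> \<rho>' v \<le> \<rho>' u}
        \<le> card {u \<in> nbrs G (verts G) v. u \<in> U \<or> \<rho> v \<le> \<rho> u}"
      by (intro card_mono) (simp_all add: finite_nbrs)
    then show ?thesis
      using old[OF v] False by (simp add: eqs)
  qed
  ultimately show "adg_inv ?B (U', D', l', \<rho>')"
    using UV RU by (auto simp: adg_inv_def eqs(1))
qed

text \<open>Every round removes a vertex, so \<open>card U\<close> decreases. The invariant is
  carried along because the nonemptiness of \<open>R\<close> relies on \<open>D\<close> holding the
  current degrees.\<close>

lemma adg_terminates: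
  assumes "\<epsilon> \<ge> 0"
  shows "\<exists>\<rho>. adg G \<epsilon> = Some \<rho>"
proof -
  let ?b = "\<lambda>(U, D, l, \<rho>). U \<noteq> {}"
  let ?P = "adg_inv (2 * (1 + \<epsilon>) * real (degeneracy G))"
  have "?P (adg_step G \<epsilon> s) \<and> card (fst (adg_step G \<epsilon> s)) < card (fst s)"
    if "?P s" "?b s" for s
  proof -
    obtain U D l \<rho> where s: "s = (U, D, l, \<rho>)"
      by (cases s)
    obtain U' D' l' \<rho>' where s': "adg_step G \<epsilon> s = (U', D', l', \<rho>')"
      by (cases "adg_step G \<epsilon> s")
    have "finite U"
      using that by (auto simp: s adg_inv_def intro: finite_subset)
    then show ?thesis
      using adg_step_inv[of \<epsilon> U D l \<rho> U' D' l' \<rho>'] that assms s s' by (auto intro: psubset_card_mono)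
  qed
  then have "\<exists>t. while_option ?b (adg_step G \<epsilon>) (verts G, \<lambda>v. int (out_degree G v), 1, \<lambda>_. 0)
      = Some t"
    by (intro measure_while_option_Some[of ?P _ _ "\<lambda>s. card (fst s)"] adg_inv_init) auto
  then show ?thesis
    by (auto simp: adg_def)
qed

text \<open>At loop exit \<open>U\<close> is empty, so the last conjunct of the invariant covers all
  vertices and its case \<open>u \<in> U\<close> disappears.\<close>

lemma adg_bound:
  assumes "\<epsilon> \<ge> 0" and "adg G \<epsilon> = Some \<rho>" and "v \<in> verts G"
  shows "real (card {u \<in> nbrs G (verts G) v. \<rho> v \<le> \<rho> u}) \<le> 2 * (1 + \<epsilon>) * real (degeneracy G)"
proof -
  let ?b = "\<lambda>(U, D, l, \<rho>). U \<noteq> {}"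
  let ?P = "adg_inv (2 * (1 + \<epsilon>) * real (degeneracy G))"
  obtain U D l where run: "while_option ?b (adg_step G \<epsilon>)
      (verts G, \<lambda>v. int (out_degree G v), 1, \<lambda>_. 0) = Some (U, D, l, \<rho>)"
    using assms(2) by (auto simp: adg_def)
  have "?P (adg_step G \<epsilon> s)" if "?P s" "?b s" for s
    using that assms(1) adg_step_inv(1) by (cases s; cases "adg_step G \<epsilon> s") auto
  then have "?P (U, D, l, \<rho>)"
    by (rule while_option_rule[where P = ?P, OF _ run adg_inv_init])
  moreover have "U = {}"
    using while_option_stop[OF run] by simp
  ultimately show ?thesis
    using assms(3) by (simp add: adg_inv_def)
qed

end

section \<open>JP as greedy coloring\<close>

text \<open>Pigeonhole: the vertices of \<open>P\<close> use at most \<open>card P\<close> of the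
  \<open>card P + 1\<close> available colors.\<close>

lemma Min_free_color:
  fixes c :: "'a \<rightharpoonup> nat"
  assumes "finite P"
  shows "Min ({1..card P + 1} - ran (c |` P)) \<in> {1..card P + 1} - ran (c |` P)"
proof (rule Min_in)
  \<comment> \<open>Uncolored vertices of \<open>P\<close> only add arbitrary values to the image on
    the right.\<close>
  have sub: "ran (c |` P) \<subseteq> (the \<circ> c) ` P"
    by (force simp: ran_def restrict_map_def split: if_splits)
  then have "card (ran (c |` P)) \<le> card P"
    using assms by (meson card_image_le card_mono finite_imageI le_trans)
  moreover have "finite (ran (c |` P))"
    using sub assms finite_surj by blast
  ultimately show "{1..card P + 1} - ran (c |` P) \<noteq> {}"
    using card_mono[of "ran (c |` P)" "{1..card P + 1}"] by auto
qed simp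

text \<open>Invariant of JP runs. Since predecessors of colored vertices are colored, a newly
  colored vertex is never a predecessor of an older one, which keeps the last condition
  stable.\<close>

definition greedy_partial_coloring ::
  "('a, 'b) pre_digraph \<Rightarrow> ('a \<Rightarrow> 'p::linorder) \<Rightarrow> ('a \<rightharpoonup> nat) \<Rightarrow> bool" where
  "greedy_partial_coloring G \<rho> c \<longleftrightarrow> dom c \<subseteq> verts G \<and>
     (\<forall>v k. c v = Some k \<longrightarrow> jp_pred G \<rho> v \<subseteq> dom c \<and> k \<in> {1..card (jp_pred G \<rho> v) + 1} \<and>
        (\<forall>u\<in>jp_pred G \<rho> v. c u \<noteq> Some k))"

lemma finite_jp_pred: "finite (verts G) \<Longrightarrow> finite (jp_pred G \<rho> v)"
  by (simp add: jp_pred_def finite_nbrs)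

lemma jp_step_greedy:
  assumes "finite (verts G)" "jp_step G \<rho> c c'" "greedy_partial_coloring G \<rho> c"
  shows "greedy_partial_coloring G \<rho> c'"
  using assms(2)
proof cases
  case (1 v k)
  let ?P = "jp_pred G \<rho> v"
  have k: "k \<in> {1..card ?P + 1} - ran (c |` ?P)"
    using Min_free_color[OF finite_jp_pred[OF assms(1)]] 1(5) by metis
  then have fresh: "c u \<noteq> Some k" if "u \<in> ?P" for u
    using that k ranI[of "c |` ?P" u k] by auto
  \<comment> \<open>Hence the update at \<open>v\<close> leaves the colors of its predecessors
    unchanged.\<close>
  have irrefl: "v \<notin> ?P"
    by (simp add: jp_pred_def)
  have inv: "dom c \<subseteq> verts G"
    "\<And>w j. c w = Some j \<Longrightarrow> jp_pred G \<rho> w \<subseteq> dom c \<and> j \<in> {1..card (jp_pred G \<rho> w) + 1} \<and>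
        (\<forall>u\<in>jp_pred G \<rho> w. c u \<noteq> Some j)"
    using assms(3) by (auto simp: greedy_partial_coloring_def)
  show ?thesis
    unfolding greedy_partial_coloring_def
  proof (intro conjI allI impI)
    show "dom c' \<subseteq> verts G"
      using inv(1) 1 by auto
  next
    fix w j
    assume w: "c' w = Some j"
    show "jp_pred G \<rho> w \<subseteq> dom c'"
      using w 1 inv(2)[of w j] by (cases "w = v") auto
    show "j \<in> {1..card (jp_pred G \<rho> w) + 1}"
      using w 1 k inv(2)[of w j] by (cases "w = v") auto
    show "\<forall>u\<in>jp_pred G \<rho> w. c' u \<noteq> Some j"
    proof (cases "w = v")
      case True
      then show ?thesis
        using w 1 fresh irrefl by auto
    next
      case False
      then have "c w = Some j"
        using w 1 by simp
      then show ?thesis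
        using inv(2)[of w j] 1 by auto
    qed
  qed
qed

lemma jp_steps_greedy:
  assumes "finite (verts G)" "(jp_step G \<rho>)\<^sup>*\<^sup>* Map.empty c"
  shows "greedy_partial_coloring G \<rho> c"
  using assms(2)
proof induction
  case base
  show ?case
    by (simp add: greedy_partial_coloring_def)
next
  case (step c c')
  then show ?case
    using jp_step_greedy assms(1) by blast
qed

text \<open>An uncolored vertex of maximal priority is always ready to be colored.\<close>

lemma jp_step_progress:
  assumes "finite (verts G)" "\<not> verts G \<subseteq> dom c"
  shows "\<exists>c'. jp_step G \<rho> c c'"
proof -
  let ?S = "verts G - dom c"
  have "Max (\<rho> ` ?S) \<in> \<rho> ` ?S"
    using assms by (intro Max_in) auto
  then obtain v where v: "v \<in> ?S" "Max (\<rho> ` ?S) = \<rho> v"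
    by blast
  have "\<not> \<rho> v < \<rho> u" if "u \<in> ?S" for u
    using that assms(1) by (simp add: not_less flip: v(2))
  then have "jp_pred G \<rho> v \<subseteq> dom c"
    unfolding jp_pred_def nbrs_def by blast
  then show ?thesis
    using v jp_step.intros[of v G c \<rho>] by blast
qed

lemma jp_output_exists:
  assumes fin: "finite (verts G)"
  shows "\<exists>c. jp_output G \<rho> c"
proof -
  \<comment> \<open>Generalized to arbitrary starting colorings, so that induction on the number of
    uncolored vertices applies after one step.\<close>
  have "\<exists>c'. (jp_step G \<rho>)\<^sup>*\<^sup>* c c' \<and> (\<nexists>c''. jp_step G \<rho> c' c'')" for c
  proof (induction "card (verts G - dom c)" arbitrary: c rule: less_induct)
    case less
    show ?case
    proof (cases "\<exists>c'. jp_step G \<rho> c c'")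
      case True
      then obtain c' where c': "jp_step G \<rho> c c'" ..
      then have "verts G - dom c' \<subset> verts G - dom c"
        by cases auto
      then have "card (verts G - dom c') < card (verts G - dom c)"
        using fin by (simp add: psubset_card_mono)
      from less[OF this] c' show ?thesis
        by (meson converse_rtranclp_into_rtranclp)
    qed blast
  qed
  then show ?thesis
    unfolding jp_output_def by blast
qed

text \<open>If a vertex were uncolored, \<open>jp_step_progress\<close> would extend the run,
  contradicting maximality.\<close>

lemma jp_output_greedy:
  assumes "finite (verts G)" "jp_output G \<rho> c"
  shows "greedy_partial_coloring G \<rho> c" "dom c = verts G"
proof -
  show "greedy_partial_coloring G \<rho> c"
    using assms jp_steps_greedy unfolding jp_output_def by blast
  then have "dom c \<subseteq> verts G"
    by (simp add: greedy_partial_coloring_def)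
  then show "dom c = verts G"
    using assms jp_step_progress unfolding jp_output_def by blast
qed

text \<open>Distinct priorities orient every edge: one endpoint is a predecessor of the other, and
  the greedy choice avoids its color.\<close>

lemma (in graph) jp_output_proper:
  assumes "inj_on \<rho> (verts G)" "jp_output G \<rho> c"
  shows "proper_coloring G c"
  unfolding proper_coloring_def
proof (intro conjI allI impI)
  note out = jp_output_greedy[OF finite_verts assms(2)]
  show "dom c = verts G"
    by (rule out(2))
  have pred: "c u \<noteq> c v" if "u \<in> jp_pred G \<rho> v" "v \<in> verts G" for u v
    using that out unfolding greedy_partial_coloring_def by (metis domD)
  fix u v
  assume uv: "u \<rightarrow>\<^bsub>G\<^esub> v"
  then have verts: "u \<in> verts G" "v \<in> verts G"
    by auto
  moreover have "u \<noteq> v"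
    using uv adj_not_same by auto
  ultimately have "\<rho> u \<noteq> \<rho> v"
    using assms(1) by (auto dest: inj_onD)
  then have "u \<in> jp_pred G \<rho> v \<or> v \<in> jp_pred G \<rho> u"
    using uv verts dominates_commute by (auto simp: jp_pred_def nbrs_def)
  then show "c u \<noteq> c v"
    using pred verts by metis
qed

lemma jp_output_card_colors_le:
  fixes B :: real
  assumes "finite (verts G)" "jp_output G \<rho> c" "B \<ge> 0"
    and B: "\<And>v. v \<in> verts G \<Longrightarrow> real (card (jp_pred G \<rho> v)) \<le> B"
  shows "real (card (ran c)) \<le> B + 1"
proof -
  \<comment> \<open>Predecessor counts are natural numbers, so the real bound \<open>B\<close> may
    be rounded down to obtain an interval of colors.\<close>
  have "ran c \<subseteq> {1..nat \<lfloor>B\<rfloor> + 1}"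
  proof
    fix k
    assume "k \<in> ran c"
    then obtain v where v: "c v = Some k"
      by (auto simp: ran_def)
    then have "v \<in> verts G" "k \<in> {1..card (jp_pred G \<rho> v) + 1}"
      using jp_output_greedy[OF assms(1,2)] by (auto simp: greedy_partial_coloring_def)
    moreover from this have "card (jp_pred G \<rho> v) \<le> nat \<lfloor>B\<rfloor>"
      using B by (simp add: le_nat_floor)
    ultimately show "k \<in> {1..nat \<lfloor>B\<rfloor> + 1}"
      by simp
  qed
  then have "card (ran c) \<le> nat \<lfloor>B\<rfloor> + 1"
    using card_mono[of "{1..nat \<lfloor>B\<rfloor> + 1}" "ran c"] by simp
  then show ?thesis
    using \<open>B \<ge> 0\<close> by linarith
qed

theorem corollary1:
  fixes G :: "('a, 'b) pre_digraph" and \<epsilon> :: real and \<rho>R :: "'a \<Rightarrow> 'r::linorder"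
  assumes "graph G"
    and "\<epsilon> > 0"
    and "inj_on \<rho>R (verts G)"
  shows "(\<exists>c. jp_adg_output G \<epsilon> \<rho>R c) \<and>
    (\<forall>c. jp_adg_output G \<epsilon> \<rho>R c \<longrightarrow>
       proper_coloring G c \<and>
       real (card (ran c)) \<le> 2 * (1 + \<epsilon>) * real (degeneracy G) + 1)"
proof -
  interpret graph G
    by (rule assms(1))
  have \<epsilon>: "\<epsilon> \<ge> 0"
    using assms(2) by simp
  have "\<exists>c. jp_adg_output G \<epsilon> \<rho>R c"
    using adg_terminates[OF \<epsilon>] jp_output_exists[OF finite_verts]
    unfolding jp_adg_output_def by blast
  moreover have "proper_coloring G c \<and> real (card (ran c)) \<le> 2 * (1 + \<epsilon>) * real (degeneracy G) + 1"
    if c: "jp_adg_output G \<epsilon> \<rho>R c" for c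
  proof -
    obtain \<rho>A where adg: "adg G \<epsilon> = Some \<rho>A" and out: "jp_output G (\<lambda>v. (\<rho>A v, \<rho>R v)) c"
      using c by (auto simp: jp_adg_output_def)
    let ?\<rho> = "\<lambda>v. (\<rho>A v, \<rho>R v)"
    \<comment> \<open>The tie-breaking component alone already separates the vertices.\<close>
    have "inj_on ?\<rho> (verts G)"
      using assms(3) by (auto simp: inj_on_def)
    moreover have "real (card (jp_pred G ?\<rho> v)) \<le> 2 * (1 + \<epsilon>) * real (degeneracy G)"
      if "v \<in> verts G" for v
    proof -
      \<comment> \<open>A lexicographically larger pair has a first component at least as large, so
        ties in \<open>\<rho>A\<close> are covered by the nonstrict comparison.\<close>
      have "card (jp_pred G ?\<rho> v) \<le> card {u \<in> nbrs G (verts G) v. \<rho>A v \<le> \<rho>A u}"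
        by (intro card_mono) (auto simp: jp_pred_def finite_nbrs)
      then show ?thesis
        using adg_bound[OF \<epsilon> adg that] by linarith
    qed
    ultimately show ?thesis
      using jp_output_proper[OF _ out] jp_output_card_colors_le[OF finite_verts out] \<epsilon> by simp
  qed
  ultimately show ?thesis
    by blast
qed

end
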